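(* Let $L$ be a finite-dimensional Leibniz $n$-algebra over a field $\mathbb{K}$ of characteristic zero, let $1\le k\le n$, and let $J$ be the $k$-solvable radical of $L$. Then $d(J)\subseteq J$ for every derivation $d$ of $L$.
   Context: A Leibniz $n$-algebra is a vector space $L$ with an $n$-linear multiplication $[-,\dots,-]$ satisfying $[[x_1,\dots,x_n],y_2,\dots,y_n]=\sum_{i=1}^n[x_1,\dots,x_{i-1},[x_i,y_2,\dots,y_n],x_{i+1},\dots,x_n]$. A derivation is a linear map $d:L\to L$ with $d([x_1,\dots,x_n])=\sum_{i=1}^n[x_1,\dots,d(x_i),\dots,x_n]$. An ideal is a subspace $I$ such that a product of $n$ elements lies in $I$ whenever at least one of the factors (in any position) lies in $I$. For an ideal $H$ of $L$ and $1\le k\le n$, put $H^{(1)_k}=H$ and let $H^{(m+1)_k}$ be the sum, over all choices of $k$ of the $n$ positions, of the spans of the products having entries from $H^{(m)_k}$ in the chosen $k$ positions and arbitrary entries from $L$ in the other $n-k$ positions. The ideal $H$ is $k$-solvable if $H^{(m)_k}=0$ for some $m$. The $k$-solvable radical of a finite-dimensional $L$ is the maximal $k$-solvable ideal of $L$, equivalently the sum of all $k$-solvable ideals of $L$. *)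

theory Defs
  imports Complex_Main
begin

text \<open>
  The underlying vector space is the whole type \<open>'v\<close> with scalar multiplication \<open>scale\<close>. The
  \<open>n\<close>-ary product is a function on lists; only its values on lists of length \<open>n\<close> are
  constrained and used. Positions are counted from \<open>0\<close>.
\<close>

locale leibniz_n_algebra = vector_space scale
  for scale :: "'k::field \<Rightarrow> 'v::ab_group_add \<Rightarrow> 'v" +
  fixes n :: nat and br :: "'v list \<Rightarrow> 'v"
  assumes n_pos: "1 \<le> n"
    and br_linear: "\<And>xs i. length xs = n \<Longrightarrow> i < n \<Longrightarrow>
      Vector_Spaces.linear scale scale (\<lambda>v. br (xs[i := v]))"
    and br_leibniz: "\<And>xs ys. length xs = n \<Longrightarrow> length ys = n - 1 \<Longrightarrow>
      br (br xs # ys) = (\<Sum>i<n. br (xs[i := br (xs ! i # ys)]))"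
begin

definition derivation :: "('v \<Rightarrow> 'v) \<Rightarrow> bool" where
  "derivation d \<longleftrightarrow> Vector_Spaces.linear scale scale d \<and>
     (\<forall>xs. length xs = n \<longrightarrow> d (br xs) = (\<Sum>i<n. br (xs[i := d (xs ! i)])))"

definition ideal :: "'v set \<Rightarrow> bool" where
  "ideal I \<longleftrightarrow> subspace I \<and>
     (\<forall>xs. length xs = n \<and> (\<exists>i<n. xs ! i \<in> I) \<longrightarrow> br xs \<in> I)"

text \<open>
  \<open>derived_series k H m\<close> is $H^{(m+1)_k}$: the index is shifted by one. The sum of a family of
  subspaces is the span of their union.
\<close>

primrec derived_series :: "nat \<Rightarrow> 'v set \<Rightarrow> nat \<Rightarrow> 'v set" where
  "derived_series k H 0 = H"
| "derived_series k H (Suc m) =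
     span (\<Union>P\<in>{P. P \<subseteq> {..<n} \<and> card P = k}.
       span {br xs | xs. length xs = n \<and> (\<forall>i\<in>P. xs ! i \<in> derived_series k H m)})"

definition solvable_ideal :: "nat \<Rightarrow> 'v set \<Rightarrow> bool" where
  "solvable_ideal k H \<longleftrightarrow> ideal H \<and> (\<exists>m. derived_series k H m = {0})"

definition solvable_radical :: "nat \<Rightarrow> 'v set" where
  "solvable_radical k = span (\<Union>{I. solvable_ideal k I})"

lemma ideal_subspace: "ideal I \<Longrightarrow> subspace I"
  by (simp add: ideal_def)

lemma br_in_ideal: "ideal I \<Longrightarrow> length xs = n \<Longrightarrow> i < n \<Longrightarrow> xs ! i \<in> I \<Longrightarrow> br xs \<in> I"
  by (auto simp: ideal_def)

lemma br_update_diff: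
  assumes "length xs = n" "i < n"
  shows "br (xs[i := u]) - br (xs[i := v]) = br (xs[i := u - v])"
proof -
  interpret l: Vector_Spaces.linear scale scale "\<lambda>v. br (xs[i := v])"
    using br_linear[OF assms] .
  show ?thesis by (simp add: l.diff)
qed

lemma br_cong_ideal:
  assumes I: "ideal I" and xs: "length xs = n" and ys: "length ys = n"
    and diff: "\<And>i. i < n \<Longrightarrow> xs ! i - ys ! i \<in> I"
  shows "br xs - br ys \<in> I"
proof -
  have "br xs - br (take j ys @ drop j xs) \<in> I" if "j \<le> n" for j
    using that
  proof (induction j)
    case 0
    then show ?case using subspace_0[OF ideal_subspace[OF I]] by simp
  next
    case (Suc j)
    let ?z = "take j ys @ drop j xs"
    have j: "j < n" and lz: "length ?z = n" using Suc.prems xs ys by auto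
    have a: "?z[j := xs ! j] = ?z"
      using j xs ys by (intro nth_equalityI) (auto simp: nth_list_update nth_append)
    have b: "?z[j := ys ! j] = take (Suc j) ys @ drop (Suc j) xs"
      using j xs ys by (intro nth_equalityI) (auto simp: nth_list_update nth_append less_Suc_eq min_def)
    have "br ?z - br (take (Suc j) ys @ drop (Suc j) xs) = br (?z[j := xs ! j - ys ! j])"
      using br_update_diff[OF lz j, of "xs ! j" "ys ! j"] a b by simp
    also have "\<dots> \<in> I"
      by (rule br_in_ideal[OF I _ j]) (use lz j diff[OF j] in auto)
    finally have 2: "br ?z - br (take (Suc j) ys @ drop (Suc j) xs) \<in> I" .
    from Suc have 1: "br xs - br ?z \<in> I" by simp
    show ?case using subspace_add[OF ideal_subspace[OF I] 1 2] by simp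
  qed
  from this[of n] show ?thesis using xs ys by simp
qed

lemma derived_series_subset:
  assumes "subspace W"
    and "\<And>P xs. P \<subseteq> {..<n} \<Longrightarrow> card P = k \<Longrightarrow> length xs = n \<Longrightarrow>
           (\<And>i. i \<in> P \<Longrightarrow> xs ! i \<in> derived_series k H m) \<Longrightarrow> br xs \<in> W"
  shows "derived_series k H (Suc m) \<subseteq> W"
  unfolding derived_series.simps
  by (intro span_minimal UN_least assms(1)) (use assms(2) in auto)

lemma br_in_derived_series:
  assumes "P \<subseteq> {..<n}" "card P = k" "length xs = n"
    "\<And>i. i \<in> P \<Longrightarrow> xs ! i \<in> derived_series k H m"
  shows "br xs \<in> derived_series k H (Suc m)"
  unfolding derived_series.simps
  by (rule span_base, rule UN_I[of P], use assms in simp, rule span_base) (use assms in auto)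

lemma subspace_derived_series:
  assumes "subspace H" shows "subspace (derived_series k H m)"
  by (cases m) (use assms in auto)

lemma derived_series_extension:
  assumes "derived_series k H m \<subseteq> B"
  shows "derived_series k H (m + j) \<subseteq> derived_series k B j"
proof (induction j)
  case (Suc j)
  have "derived_series k H (Suc (m + j)) \<subseteq> derived_series k B (Suc j)"
  proof (rule derived_series_subset)
    show "subspace (derived_series k B (Suc j))" by simp
  next
    fix P xs
    assume "P \<subseteq> {..<n}" "card P = k" "length xs = n"
      and "\<And>i. i \<in> P \<Longrightarrow> xs ! i \<in> derived_series k H (m + j)"
    with Suc show "br xs \<in> derived_series k B (Suc j)"
      by (intro br_in_derived_series[of P]) blast+
  qed
  then show ?case by simp
qed (use assms in simp)

lemma solvable_ideal_sum:
  assumes A: "solvable_ideal k A" and B: "solvable_ideal k B"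
  shows "solvable_ideal k (span (A \<union> B))"
proof -
  have iA: "ideal A" and iB: "ideal B" using A B by (auto simp: solvable_ideal_def)
  have sA: "subspace A" and sB: "subspace B" using iA iB by (auto intro: ideal_subspace)
  let ?S = "span (A \<union> B)"
  let ?W = "\<lambda>m. {a + b | a b. a \<in> derived_series k A m \<and> b \<in> B}"
  have sum: "?S = {a + b | a b. a \<in> A \<and> b \<in> B}"
    using sA sB by (auto simp: span_Un span_eq_iff[THEN iffD2])
  have sW: "subspace (?W m)" for m
    by (rule subspace_sums[OF subspace_derived_series[OF sA] sB])
  have ser: "derived_series k ?S m \<subseteq> ?W m" for m
  proof (induction m)
    case 0
    then show ?case using sum by simp
  next
    case (Suc m)
    show ?case
    proof (rule derived_series_subset[OF sW])
      fix P xs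
      assume P: "P \<subseteq> {..<n}" "card P = k" and l: "length xs = n"
        and x: "\<And>i. i \<in> P \<Longrightarrow> xs ! i \<in> derived_series k ?S m"
      have "\<forall>i. \<exists>a. i \<in> P \<longrightarrow> a \<in> derived_series k A m \<and> xs ! i - a \<in> B"
        using x Suc by fastforce
      then obtain f where f: "\<And>i. i \<in> P \<Longrightarrow> f i \<in> derived_series k A m"
        "\<And>i. i \<in> P \<Longrightarrow> xs ! i - f i \<in> B" by metis
      define ys where "ys = map (\<lambda>i. if i \<in> P then f i else xs ! i) [0..<n]"
      have ly: "length ys = n" by (simp add: ys_def)
      have "br ys \<in> derived_series k A (Suc m)"
        by (rule br_in_derived_series[OF P ly]) (use f P in \<open>auto simp: ys_def\<close>)
      moreover have "br xs - br ys \<in> B"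
        by (rule br_cong_ideal[OF iB l ly]) (use f subspace_0[OF sB] in \<open>auto simp: ys_def\<close>)
      moreover have "br xs = br ys + (br xs - br ys)" by simp
      ultimately show "br xs \<in> ?W (Suc m)" by blast
    qed
  qed
  obtain p q where p: "derived_series k A p = {0}" and q: "derived_series k B q = {0}"
    using A B by (auto simp: solvable_ideal_def)
  have "derived_series k ?S p \<subseteq> B" using ser[of p] p by auto
  then have "derived_series k ?S (p + q) \<subseteq> {0}"
    using derived_series_extension[of k ?S p B q] q by simp
  moreover have "0 \<in> derived_series k ?S (p + q)"
    by (intro subspace_0 subspace_derived_series) simp
  moreover have "ideal ?S"
    unfolding ideal_def
  proof (intro conjI allI impI)
    fix xs assume "length xs = n \<and> (\<exists>i<n. xs ! i \<in> ?S)"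
    then obtain i a b where l: "length xs = n" and i: "i < n"
      and ab: "a \<in> A" "b \<in> B" "xs ! i = a + b" using sum by auto
    have "br (xs[i := a]) \<in> A" by (rule br_in_ideal[OF iA _ i]) (use l i ab in auto)
    moreover have "br (xs[i := xs ! i]) - br (xs[i := a]) \<in> B"
      unfolding br_update_diff[OF l i]
      by (rule br_in_ideal[OF iB _ i]) (use l i ab in auto)
    moreover have "br xs = br (xs[i := a]) + (br (xs[i := xs ! i]) - br (xs[i := a]))" by simp
    ultimately show "br xs \<in> ?S" using sum by blast
  qed simp
  ultimately show ?thesis unfolding solvable_ideal_def by blast
qed

lemma solvable_ideal_0: "solvable_ideal k {0}"
proof -
  have "br xs = 0" if "length xs = n" "i < n" "xs ! i = 0" for xs i
    using br_update_diff[OF that(1,2), of 0 0] that by (metis diff_self list_update_id)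
  then have "ideal {0}" by (auto simp: ideal_def)
  moreover have "derived_series k {0} 0 = {0}" by simp
  ultimately show ?thesis unfolding solvable_ideal_def by blast
qed

text \<open>In finite dimension the sum of all \<open>k\<close>-solvable ideals is the largest one.\<close>

theorem solvable_radical_greatest:
  assumes "finite_dimensional_vector_space scale Basis"
  shows "solvable_ideal k (solvable_radical k)"
    and "solvable_ideal k I \<Longrightarrow> I \<subseteq> solvable_radical k"
proof -
  interpret f: finite_dimensional_vector_space scale Basis by fact
  obtain M where M: "solvable_ideal k M"
    and max: "\<And>I. solvable_ideal k I \<Longrightarrow> dim I \<le> dim M"
  proof -
    have "\<exists>M. solvable_ideal k M \<and> (\<forall>I. solvable_ideal k I \<longrightarrow> dim I \<le> dim M)"
      by (rule ex_has_greatest_nat[of _ "{0}" _ "Suc (card Basis)"])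
        (use solvable_ideal_0 f.dim_subset_UNIV f.dimension_def in \<open>auto simp: less_Suc_eq_le\<close>)
    then show thesis using that by blast
  qed
  have sM: "subspace M" using M by (auto simp: solvable_ideal_def ideal_def)
  have le: "I \<subseteq> M" if "solvable_ideal k I" for I
  proof -
    have "M = span (M \<union> I)"
      by (rule f.subspace_dim_equal[OF sM subspace_span])
        (use max[OF solvable_ideal_sum[OF M that]] in \<open>auto intro: span_base\<close>)
    then show ?thesis by (metis Un_upper2 span_superset subset_trans)
  qed
  have "solvable_radical k \<subseteq> M"
    unfolding solvable_radical_def by (rule span_minimal[OF _ sM]) (use le in auto)
  moreover show *: "I \<subseteq> solvable_radical k" if "solvable_ideal k I" for I
    unfolding solvable_radical_def using that by (auto intro: span_base)
  ultimately have "solvable_radical k = M" using *[OF M] by auto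
  then show "solvable_ideal k (solvable_radical k)" using M by simp
qed

end

end

theory Submission
  imports Defs "HOL-Library.Function_Algebras"
begin

text \<open>
  Let \<open>I\<close> be a \<open>k\<close>-solvable ideal. Over the power series in \<open>t\<close>, \<open>exp (t d)\<close> is an automorphism
  of \<open>L[[t]]\<close>, so \<open>M = I[[t]] + exp (t d) I[[t]]\<close> is a sum of two \<open>k\<close>-solvable ideals and hence
  \<open>k\<close>-solvable. Up to a nonzero multinomial factor, a product of leading coefficients of series is
  zero or the leading coefficient of the product, so the leading coefficients of the elements of \<open>M\<close>
  form a \<open>k\<close>-solvable ideal of \<open>L\<close>. It contains \<open>d x\<close> for \<open>x \<in> I\<close>, because
  \<open>exp (t d) x - x = t d x + \<dots>\<close>.
\<close>

lemma sum_fun_apply: "(\<Sum>i\<in>A. f i) x = (\<Sum>i\<in>A. f i x)"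
  by (induction A rule: infinite_finite_induct) (auto simp: plus_fun_apply)

text \<open>As a simp rule this would also rewrite \<open>f + g\<close> to \<open>\<lambda>x. f x + g x\<close>.\<close>

declare plus_fun_apply [simp del]

context leibniz_n_algebra
begin

section \<open>Linearity in single slots and surjective images of solvable ideals\<close>

lemma br_update_add:
  assumes "length xs = n" "i < n"
  shows "br (xs[i := u + v]) = br (xs[i := u]) + br (xs[i := v])"
proof -
  interpret l: Vector_Spaces.linear scale scale "\<lambda>v. br (xs[i := v])"
    using br_linear[OF assms] .
  show ?thesis by (simp add: l.add)
qed

lemma br_update_scale:
  assumes "length xs = n" "i < n"
  shows "br (xs[i := scale c v]) = scale c (br (xs[i := v]))"
proof -
  interpret l: Vector_Spaces.linear scale scale "\<lambda>v. br (xs[i := v])"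
    using br_linear[OF assms] .
  show ?thesis by (simp add: l.scale)
qed

lemma br_eq_0:
  assumes "length xs = n" "i < n" "xs ! i = 0"
  shows "br xs = 0"
  using br_update_scale[OF assms(1,2), of 0 0] assms by (metis list_update_id scale_zero_left)

text \<open>Surjectivity lifts a whole tuple entry by entry, with the entries at \<open>P\<close>
  lifted into \<open>A\<close>; hence each derived term of the image lies in the image of the
  derived term. It is meant for \<open>hexp d\<close> acting on the series algebra.\<close>

lemma solvable_ideal_image:
  assumes lin: "Vector_Spaces.linear scale scale f" and sur: "surj f"
    and hom: "\<And>xs. length xs = n \<Longrightarrow> br (map f xs) = f (br xs)"
    and H: "solvable_ideal k H"
  shows "solvable_ideal k (f ` H)"
proof -
  interpret f: Vector_Spaces.linear scale scale f by fact
  have iH: "ideal H" using H by (simp add: solvable_ideal_def)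
  have sH: "subspace H" using ideal_subspace[OF iH] .
  have lift: "\<exists>ys. length ys = n \<and> map f ys = xs \<and> (\<forall>i\<in>P. ys ! i \<in> A)"
    if "length xs = n" "\<And>i. i \<in> P \<Longrightarrow> xs ! i \<in> f ` A" "P \<subseteq> {..<n}" for xs P A
  proof -
    have "\<exists>y. f y = xs ! i \<and> (i \<in> P \<longrightarrow> y \<in> A)" for i
      using that(2)[of i] surjD[OF sur, of "xs ! i"] by (metis imageE)
    then obtain g where g: "\<And>i. f (g i) = xs ! i" "\<And>i. i \<in> P \<Longrightarrow> g i \<in> A" by metis
    show ?thesis
      by (rule exI[of _ "map g [0..<n]"]) (use g that in \<open>auto intro!: nth_equalityI simp: subset_iff\<close>)
  qed
  have "ideal (f ` H)"
    unfolding ideal_def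
  proof (intro conjI allI impI)
    show "subspace (f ` H)" by (rule f.subspace_image[OF sH])
    fix xs assume xs: "length xs = n \<and> (\<exists>i<n. xs ! i \<in> f ` H)"
    then obtain i where i: "i < n" "xs ! i \<in> f ` H" by auto
    obtain ys where "length ys = n" "map f ys = xs" "ys ! i \<in> H"
      using lift[of xs "{i}" H] xs i by auto
    then show "br xs \<in> f ` H"
      using hom[of ys] br_in_ideal[OF iH _ i(1), of ys] by auto
  qed
  moreover have ser: "derived_series k (f ` H) m \<subseteq> f ` derived_series k H m" for m
  proof (induction m)
    case (Suc m)
    show ?case
    proof (rule derived_series_subset)
      show "subspace (f ` derived_series k H (Suc m))"
        by (rule f.subspace_image[OF subspace_derived_series[OF sH]])
      fix P xs
      assume P: "P \<subseteq> {..<n}" "card P = k" and l: "length xs = n"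
        and x: "\<And>i. i \<in> P \<Longrightarrow> xs ! i \<in> derived_series k (f ` H) m"
      obtain ys where ys: "length ys = n" "map f ys = xs" "\<forall>i\<in>P. ys ! i \<in> derived_series k H m"
        using lift[of xs P "derived_series k H m"] l x Suc P by blast
      have "br ys \<in> derived_series k H (Suc m)"
        by (rule br_in_derived_series[OF P ys(1)]) (use ys in auto)
      then show "br xs \<in> f ` derived_series k H (Suc m)" using hom[OF ys(1)] ys by auto
    qed
  qed simp
  moreover obtain m where m: "derived_series k H m = {0}" using H by (auto simp: solvable_ideal_def)
  moreover have "0 \<in> derived_series k (f ` H) m"
    by (intro subspace_0 subspace_derived_series f.subspace_image sH)
  ultimately show ?thesis using ser[of m] unfolding solvable_ideal_def by (auto intro!: exI[of _ m])
qed

section \<open>The Leibniz n-algebra of Hurwitz series\<close>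

text \<open>
  The sequence \<open>f\<close> stands for the Hurwitz series \<open>\<Sum>m. f m t\<^sup>m / m!\<close>. With this normalisation
  \<open>hderiv\<close> is differentiation in \<open>t\<close>, and the recursion below is the requirement that it be a
  derivation of the \<open>t\<close>-multilinear extension of the product.
\<close>

definition hderiv :: "(nat \<Rightarrow> 'v) \<Rightarrow> nat \<Rightarrow> 'v" where
  "hderiv f m = f (Suc m)"

primrec hcoeff :: "nat \<Rightarrow> (nat \<Rightarrow> 'v) list \<Rightarrow> 'v" where
  "hcoeff 0 F = br (map (\<lambda>f. f 0) F)"
| "hcoeff (Suc m) F = (\<Sum>i<n. hcoeff m (F[i := hderiv (F ! i)]))"

definition hbr :: "(nat \<Rightarrow> 'v) list \<Rightarrow> nat \<Rightarrow> 'v" where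
  "hbr F m = hcoeff m F"

text \<open>The scalars stay in the ground field and are not power series; closure under
  multiplication by \<open>t\<close> is therefore a separate condition, expressed later through
  \<open>tmult\<close>.\<close>

definition hscale :: "'k \<Rightarrow> (nat \<Rightarrow> 'v) \<Rightarrow> nat \<Rightarrow> 'v" where
  "hscale c f m = scale c (f m)"

lemma hbr_0: "hbr F 0 = br (map (\<lambda>f. f 0) F)"
  by (simp add: hbr_def)

lemma hbr_Suc: "hbr F (Suc m) = (\<Sum>i<n. hbr (F[i := hderiv (F ! i)]) m)"
  by (simp add: hbr_def)

lemma hderiv_hbr: "hderiv (hbr F) = (\<Sum>i<n. hbr (F[i := hderiv (F ! i)]))"
  by (simp add: fun_eq_iff hderiv_def hbr_Suc sum_fun_apply)

text \<open>The product rule with slot \<open>i\<close> singled out: the derivative hits either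
  \<open>h\<close> or another slot. Slot \<open>i\<close> stays visible in every term, as inductions
  about a single slot require.\<close>

lemma hbr_update_Suc:
  assumes "length F = n" "i < n"
  shows "hbr (F[i := h]) (Suc m) =
    hbr (F[i := hderiv h]) m + (\<Sum>j\<in>{..<n} - {i}. hbr (F[j := hderiv (F ! j), i := h]) m)"
proof -
  have "hbr (F[i := h]) (Suc m) = hbr (F[i := h, i := hderiv (F[i := h] ! i)]) m +
      (\<Sum>j\<in>{..<n} - {i}. hbr (F[i := h, j := hderiv (F[i := h] ! j)]) m)"
    unfolding hbr_Suc by (rule sum.remove) (use assms in auto)
  also have "(\<Sum>j\<in>{..<n} - {i}. hbr (F[i := h, j := hderiv (F[i := h] ! j)]) m) =
      (\<Sum>j\<in>{..<n} - {i}. hbr (F[j := hderiv (F ! j), i := h]) m)"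
    by (rule sum.cong) (auto simp: list_update_swap)
  finally show ?thesis using assms by simp
qed

lemma vector_space_hscale: "vector_space hscale"
  by unfold_locales (auto simp: hscale_def fun_eq_iff plus_fun_apply scale_right_distrib scale_left_distrib)

lemma hbr_linear:
  assumes F: "length F = n" and i: "i < n"
  shows "Vector_Spaces.linear hscale hscale (\<lambda>f. hbr (F[i := f]))"
proof -
  interpret V: vector_space hscale by (rule vector_space_hscale)
  have "hbr (F[i := f + g]) m = hbr (F[i := f]) m + hbr (F[i := g]) m" for f g m
    using F
  proof (induction m arbitrary: F f g)
    case 0
    then show ?case using i by (simp add: hbr_0 map_update br_update_add plus_fun_apply)
  next
    case (Suc m)
    have "hderiv (f + g) = hderiv f + hderiv g"
      by (simp add: fun_eq_iff hderiv_def plus_fun_apply)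
    then show ?case
      using Suc i by (simp add: hbr_update_Suc sum.distrib)
  qed
  moreover have "hbr (F[i := hscale c f]) m = scale c (hbr (F[i := f]) m)" for c f m
    using F
  proof (induction m arbitrary: F f)
    case 0
    then show ?case using i by (simp add: hbr_0 map_update br_update_scale hscale_def)
  next
    case (Suc m)
    have "hderiv (hscale c f) = hscale c (hderiv f)" by (simp add: fun_eq_iff hscale_def hderiv_def)
    then show ?case
      using Suc i by (simp add: hbr_update_Suc scale_right_distrib scale_sum_right)
  qed
  ultimately show ?thesis
    by unfold_locales (auto simp: fun_eq_iff hscale_def plus_fun_apply)
qed

lemma hbr_update_add:
  assumes "length F = n" "i < n"
  shows "hbr (F[i := f + g]) = hbr (F[i := f]) + hbr (F[i := g])"
proof -
  interpret l: Vector_Spaces.linear hscale hscale "\<lambda>v. hbr (F[i := v])"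
    using hbr_linear[OF assms] .
  show ?thesis by (simp add: l.add)
qed

lemma hbr_update_sum:
  assumes "length F = n" "i < n"
  shows "hbr (F[i := sum f A]) = (\<Sum>a\<in>A. hbr (F[i := f a]))"
proof -
  interpret l: Vector_Spaces.linear hscale hscale "\<lambda>v. hbr (F[i := v])"
    using hbr_linear[OF assms] .
  show ?thesis by (simp add: l.sum)
qed

text \<open>An operator \<open>e\<close> is applied in one slot after a derivative in one slot.
  After swapping the sums, the terms where both meet in slot \<open>i\<close> are split from those
  with the derivative elsewhere, which is the shape of \<open>hbr_update_Suc\<close>. The cases of
  interest are a bracket with fixed \<open>G\<close> and \<open>hmap d\<close>.\<close>

lemma sum_hbr_update_hderiv:
  assumes F: "length F = n"
  shows "(\<Sum>j<n. \<Sum>i<n. hbr (F[j := hderiv (F ! j), i := e (F[j := hderiv (F ! j)] ! i)]) m) =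
    (\<Sum>i<n. hbr (F[i := e (hderiv (F ! i))]) m +
      (\<Sum>j\<in>{..<n} - {i}. hbr (F[j := hderiv (F ! j), i := e (F ! i)]) m))"
proof -
  let ?D = "\<lambda>j. F[j := hderiv (F ! j)]"
  have "(\<Sum>j<n. \<Sum>i<n. hbr ((?D j)[i := e (?D j ! i)]) m) =
      (\<Sum>i<n. \<Sum>j<n. hbr ((?D j)[i := e (?D j ! i)]) m)"
    by (rule sum.swap)
  also have "\<dots> = (\<Sum>i<n. hbr (F[i := e (hderiv (F ! i))]) m +
      (\<Sum>j\<in>{..<n} - {i}. hbr ((?D j)[i := e (F ! i)]) m))"
  proof (rule sum.cong)
    fix i assume i: "i \<in> {..<n}"
    have "(\<Sum>j<n. hbr ((?D j)[i := e (?D j ! i)]) m) =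
        hbr ((?D i)[i := e (?D i ! i)]) m +
        (\<Sum>j\<in>{..<n} - {i}. hbr ((?D j)[i := e (?D j ! i)]) m)"
      by (rule sum.remove) (use i in auto)
    then show "(\<Sum>j<n. hbr ((?D j)[i := e (?D j ! i)]) m) =
        hbr (F[i := e (hderiv (F ! i))]) m +
        (\<Sum>j\<in>{..<n} - {i}. hbr ((?D j)[i := e (F ! i)]) m)"
      using F i by simp
  qed simp
  finally show ?thesis .
qed

text \<open>The constant term is the identity in \<open>L\<close>. Differentiating both sides gives
  sums of the same identity with one entry of \<open>F\<close> or of \<open>G\<close>
  differentiated, so the coefficients agree by induction.\<close>

lemma hbr_leibniz:
  assumes "length F = n" and "length G = n - 1"
  shows "hbr (hbr F # G) m = (\<Sum>i<n. hbr (F[i := hbr (F ! i # G)]) m)"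
  using assms
proof (induction m arbitrary: F G)
  case 0
  have "map (\<lambda>f. f 0) (F[i := hbr (F ! i # G)]) =
      (map (\<lambda>f. f 0) F)[i := br ((map (\<lambda>f. f 0) F) ! i # map (\<lambda>f. f 0) G)]"
    if "i < n" for i
    using that 0 by (simp add: map_update hbr_0)
  then show ?case using 0 by (simp add: hbr_0 br_leibniz)
next
  case (Suc m)
  let ?D = "\<lambda>F j. F[j := hderiv (F ! j)]"
  have n: "n = Suc (n - 1)" using n_pos by simp
  have cons: "hderiv (hbr (f # G)) = hbr (hderiv f # G) + (\<Sum>p<n-1. hbr (f # ?D G p))" for f
  proof -
    have "hderiv (hbr (f # G)) = (\<Sum>i<Suc (n - 1). hbr ((f # G)[i := hderiv ((f # G) ! i)]))"
      unfolding hderiv_hbr using n by simp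
    then show ?thesis unfolding sum.lessThan_Suc_shift by simp
  qed
  \<comment> \<open>The leading \<open>0\<close> is a placeholder that is overwritten at position
    \<open>0\<close>, so linearity in a slot applies to the head of a \<open>Cons\<close>.\<close>
  have sum_head: "hbr (sum f A # G) = (\<Sum>a\<in>A. hbr (f a # G))" for f and A :: "nat set"
    using hbr_update_sum[of "0 # G" 0 f A] Suc.prems n by simp
  have F: "length F = n" and G: "length G = n - 1" using Suc.prems by auto
  have "hbr (hbr F # G) (Suc m) = hderiv (hbr (hbr F # G)) m" by (simp add: hderiv_def)
  also have "\<dots> = (\<Sum>j<n. hbr (hbr (?D F j) # G) m) + (\<Sum>p<n-1. hbr (hbr F # ?D G p) m)"
    unfolding cons hderiv_hbr[of F] by (simp add: sum_head sum_fun_apply plus_fun_apply)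
  also have "(\<Sum>j<n. hbr (hbr (?D F j) # G) m) =
      (\<Sum>j<n. \<Sum>i<n. hbr ((?D F j)[i := hbr (?D F j ! i # G)]) m)"
    using F G by (simp add: Suc.IH)
  also have "\<dots> = (\<Sum>i<n. hbr (F[i := hbr (hderiv (F ! i) # G)]) m +
      (\<Sum>j\<in>{..<n} - {i}. hbr ((?D F j)[i := hbr (F ! i # G)]) m))"
    by (rule sum_hbr_update_hderiv[OF F])
  also have "(\<Sum>p<n-1. hbr (hbr F # ?D G p) m) =
      (\<Sum>p<n-1. \<Sum>i<n. hbr (F[i := hbr (F ! i # ?D G p)]) m)"
    using F G by (simp add: Suc.IH)
  also have "\<dots> = (\<Sum>i<n. \<Sum>p<n-1. hbr (F[i := hbr (F ! i # ?D G p)]) m)"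
    by (rule sum.swap)
  finally have "hbr (hbr F # G) (Suc m) =
      (\<Sum>i<n. hbr (F[i := hderiv (hbr (F ! i # G))]) m +
        (\<Sum>j\<in>{..<n} - {i}. hbr ((?D F j)[i := hbr (F ! i # G)]) m))"
    unfolding cons using F
    by (simp add: hbr_update_add hbr_update_sum sum_fun_apply plus_fun_apply sum.distrib)
  then show ?case using F by (simp add: hbr_update_Suc)
qed

lemma leibniz_n_algebra_hurwitz: "leibniz_n_algebra hscale n hbr"
  using n_pos hbr_linear hbr_leibniz
  by (intro leibniz_n_algebra.intro leibniz_n_algebra_axioms.intro)
    (auto simp: fun_eq_iff sum_fun_apply vector_space_hscale)

section \<open>The exponential of a derivation as an automorphism\<close>

definition hmap :: "('v \<Rightarrow> 'v) \<Rightarrow> (nat \<Rightarrow> 'v) \<Rightarrow> nat \<Rightarrow> 'v" where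
  "hmap e f m = e (f m)"

text \<open>
  The exponential \<open>exp (t d)\<close>, characterised by its constant term and
  \<open>(exp (t d) f)' = exp (t d) (d f + f')\<close>.
\<close>

primrec hexp :: "('v \<Rightarrow> 'v) \<Rightarrow> (nat \<Rightarrow> 'v) \<Rightarrow> nat \<Rightarrow> 'v" where
  "hexp d f 0 = f 0"
| "hexp d f (Suc m) = hexp d (hmap d f + hderiv f) m"

lemma hderiv_hexp: "hderiv (hexp d f) = hexp d (hmap d f + hderiv f)"
  by (simp add: hderiv_def fun_eq_iff)

lemma hexp_add:
  assumes d: "\<And>u v. d (u + v) = d u + d v"
  shows "hexp d (f + g) = hexp d f + hexp d g"
proof
  have "hexp d (f + g) m = hexp d f m + hexp d g m" for m
  proof (induction m arbitrary: f g)
    case (Suc m)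
    have "hmap d (f + g) + hderiv (f + g) = (hmap d f + hderiv f) + (hmap d g + hderiv g)"
      by (simp add: fun_eq_iff hmap_def hderiv_def plus_fun_apply d algebra_simps)
    then show ?case using Suc[of "hmap d f + hderiv f" "hmap d g + hderiv g"] by simp
  qed (simp add: plus_fun_apply)
  then show "hexp d (f + g) m = (hexp d f + hexp d g) m" for m by (simp add: plus_fun_apply)
qed

text \<open>Used twice: \<open>e\<close> as a scalar gives homogeneity of \<open>hexp d\<close>, and
  \<open>e\<close> as \<open>- d\<close> gives its inverse.\<close>

lemma hexp_hmap:
  assumes e: "\<And>u v. e (u + v) = e u + e v" and comm: "\<And>v. d (e v) = e (d v)"
  shows "hexp d (hmap e f) = hmap e (hexp d f)"
proof
  have "hexp d (hmap e f) m = e (hexp d f m)" for m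
  proof (induction m arbitrary: f)
    case (Suc m)
    have "hmap d (hmap e f) + hderiv (hmap e f) = hmap e (hmap d f + hderiv f)"
      by (simp add: fun_eq_iff hmap_def hderiv_def plus_fun_apply e comm)
    then show ?case using Suc[of "hmap d f + hderiv f"] by simp
  qed (simp add: hmap_def)
  then show "hexp d (hmap e f) m = hmap e (hexp d f) m" for m by (simp add: hmap_def)
qed

text \<open>In the derivative of the composite, \<open>- d\<close> from the outer exponential
  cancels \<open>d\<close> from the inner one. What remains is the composite applied to
  \<open>hderiv f\<close>, so induction on the coefficient index applies.\<close>

lemma hexp_inverse:
  assumes d: "\<And>u v. d (u + v) = d u + d v"
  shows "hexp (\<lambda>v. - d v) (hexp d f) = f"
proof
  have uminus: "d (- v) = - d v" for v
    using d[of v "- v"] d[of 0 0] by (simp add: eq_neg_iff_add_eq_0 add.commute)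
  show "hexp (\<lambda>v. - d v) (hexp d f) m = f m" for m
  proof (induction m arbitrary: f)
    case (Suc m)
    have "hmap (\<lambda>v. - d v) (hexp d f) + hderiv (hexp d f) =
        hexp d (hmap (\<lambda>v. - d v) f + (hmap d f + hderiv f))"
      unfolding hderiv_hexp hexp_add[of d, OF d]
      by (subst hexp_hmap) (simp_all add: d uminus)
    also have "hmap (\<lambda>v. - d v) f + (hmap d f + hderiv f) = hderiv f"
      by (simp add: fun_eq_iff hmap_def plus_fun_apply)
    finally have "hexp (\<lambda>v. - d v) (hexp d f) (Suc m) = hexp (\<lambda>v. - d v) (hexp d (hderiv f)) m"
      by simp
    then show ?case unfolding Suc[of "hderiv f"] by (simp add: hderiv_def)
  qed simp
qed

lemma hexp_linear:
  assumes "Vector_Spaces.linear scale scale d"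
  shows "Vector_Spaces.linear hscale hscale (hexp d)"
proof -
  interpret d: Vector_Spaces.linear scale scale d by fact
  interpret V: vector_space hscale by (rule vector_space_hscale)
  have "hexp d (hscale c f) = hscale c (hexp d f)" for c f
    using hexp_hmap[of "scale c" d f]
    by (simp add: scale_right_distrib d.scale hmap_def[abs_def] hscale_def[abs_def])
  then show ?thesis
    by unfold_locales (auto simp: hexp_add d.add plus_fun_apply)
qed

text \<open>Coefficientwise \<open>d\<close> commutes with \<open>hderiv\<close>, so the derivation
  law propagates from the constant term to all coefficients.\<close>

lemma hmap_derivation_hbr:
  assumes der: "derivation d" and F: "length F = n"
  shows "hmap d (hbr F) = (\<Sum>i<n. hbr (F[i := hmap d (F ! i)]))"
proof
  interpret d: Vector_Spaces.linear scale scale d using der by (simp add: derivation_def)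
  have d: "d (br xs) = (\<Sum>i<n. br (xs[i := d (xs ! i)]))" if "length xs = n" for xs
    using der that by (simp add: derivation_def)
  show "hmap d (hbr F) m = (\<Sum>i<n. hbr (F[i := hmap d (F ! i)])) m" for m
    using F
  proof (induction m arbitrary: F)
    case 0
    then show ?case
      by (simp add: hmap_def hbr_0 d sum_fun_apply map_update)
  next
    case (Suc m)
    let ?D = "\<lambda>j. F[j := hderiv (F ! j)]"
    have "hmap d (hbr F) (Suc m) = (\<Sum>j<n. hmap d (hbr (?D j)) m)"
      by (simp add: hmap_def hbr_Suc d.sum)
    also have "\<dots> = (\<Sum>j<n. \<Sum>i<n. hbr ((?D j)[i := hmap d (?D j ! i)]) m)"
      using Suc by (simp add: sum_fun_apply)
    also have "\<dots> = (\<Sum>i<n. hbr (F[i := hmap d (hderiv (F ! i))]) m +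
        (\<Sum>j\<in>{..<n} - {i}. hbr ((?D j)[i := hmap d (F ! i)]) m))"
      by (rule sum_hbr_update_hderiv[OF Suc.prems])
    also have "\<dots> = (\<Sum>i<n. hbr (F[i := hmap d (F ! i)]) (Suc m))"
      using Suc.prems by (simp add: hbr_update_Suc hmap_def[abs_def] hderiv_def[abs_def])
    finally show ?case by (simp add: sum_fun_apply)
  qed
qed

text \<open>The operator \<open>hmap d\<close> plus \<open>hderiv\<close> is a derivation of
  \<open>hbr\<close>, and \<open>hderiv_hexp\<close> moves it inside the exponential. Both sides
  thus have the same constant term and satisfy the same recursion.\<close>

lemma hexp_hbr:
  assumes der: "derivation d" and F: "length F = n"
  shows "hbr (map (hexp d) F) = hexp d (hbr F)"
proof
  have d: "Vector_Spaces.linear scale scale d" using der by (simp add: derivation_def)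
  interpret e: Vector_Spaces.linear hscale hscale "hexp d" by (rule hexp_linear[OF d])
  show "hbr (map (hexp d) F) m = hexp d (hbr F) m" for m
    using F
  proof (induction m arbitrary: F)
    case 0
    then show ?case by (simp add: hbr_0 comp_def)
  next
    case (Suc m)
    let ?E = "\<lambda>i. F[i := hmap d (F ! i) + hderiv (F ! i)]"
    have "hmap d (hbr F) + hderiv (hbr F) = (\<Sum>i<n. hbr (?E i))"
      unfolding hmap_derivation_hbr[OF der Suc.prems] hderiv_hbr sum.distrib[symmetric]
      by (rule sum.cong) (use Suc.prems in \<open>auto simp: hbr_update_add\<close>)
    then have "hexp d (hbr F) (Suc m) = (\<Sum>i<n. hexp d (hbr (?E i)) m)"
      by (simp add: e.sum sum_fun_apply)
    also have "\<dots> = (\<Sum>i<n. hbr (map (hexp d) (?E i)) m)"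
      using Suc by simp
    also have "\<dots> = hbr (map (hexp d) F) (Suc m)"
      unfolding hbr_Suc
      by (rule sum.cong) (use Suc.prems in \<open>auto simp: map_update hderiv_hexp\<close>)
    finally show ?case by simp
  qed
qed

section \<open>Multiplication by \<open>t\<close>\<close>

text \<open>The factor \<open>m\<close> comes from the Hurwitz normalisation: \<open>t\<close> times
  \<open>t^(m-1) / (m-1)!\<close> is \<open>m\<close> times \<open>t^m / m!\<close>. At
  \<open>m = 0\<close> it also cancels the value at the truncated index
  \<open>0 - 1\<close>.\<close>

definition tmult :: "(nat \<Rightarrow> 'v) \<Rightarrow> nat \<Rightarrow> 'v" where
  "tmult f m = scale (of_nat m) (f (m - 1))"

lemma hderiv_tmult: "hderiv (tmult f) = tmult (hderiv f) + f"
proof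
  show "hderiv (tmult f) m = (tmult (hderiv f) + f) m" for m
    by (cases "m = 0")
      (simp_all add: hderiv_def tmult_def plus_fun_apply scale_left_distrib add.commute)
qed

lemma tmult_linear: "Vector_Spaces.linear hscale hscale tmult"
proof -
  interpret V: vector_space hscale by (rule vector_space_hscale)
  show ?thesis
    by unfold_locales
      (auto simp: fun_eq_iff tmult_def hscale_def plus_fun_apply scale_right_distrib mult.commute)
qed

text \<open>The exponential is linear over \<open>t\<close>: differentiating either side yields
  \<open>t\<close> times the derivative of \<open>hexp d f\<close>, plus \<open>hexp d f\<close>.
  This later keeps the image of a \<open>t\<close>-stable ideal \<open>t\<close>-stable.\<close>

lemma hexp_tmult:
  assumes d: "Vector_Spaces.linear scale scale d"
  shows "hexp d (tmult f) = tmult (hexp d f)"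
proof
  interpret d: Vector_Spaces.linear scale scale d by fact
  show "hexp d (tmult f) m = tmult (hexp d f) m" for m
  proof (induction m arbitrary: f)
    case 0
    then show ?case by (simp add: tmult_def)
  next
    case (Suc m)
    let ?D = "hmap d f + hderiv f"
    have "hmap d (tmult f) + hderiv (tmult f) = tmult ?D + f"
      unfolding hderiv_tmult
      by (simp add: fun_eq_iff hmap_def tmult_def plus_fun_apply d.scale scale_right_distrib)
    then have "hexp d (tmult f) (Suc m) = tmult (hexp d ?D) m + hexp d f m"
      unfolding Suc[of ?D, symmetric] plus_fun_apply[of _ _ m, symmetric]
        hexp_add[of d, OF d.add, symmetric] by simp
    also have "\<dots> = hderiv (tmult (hexp d f)) m"
      by (simp add: hderiv_tmult hderiv_hexp plus_fun_apply)
    finally show ?case by (simp add: hderiv_def)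
  qed
qed

text \<open>The product rule for \<open>tmult\<close> in slot \<open>i\<close> leaves one extra term
  \<open>hbr F\<close>, the same one that differentiating \<open>tmult (hbr F)\<close>
  leaves.\<close>

lemma hbr_tmult:
  assumes F: "length F = n" and i: "i < n"
  shows "hbr (F[i := tmult (F ! i)]) = tmult (hbr F)"
proof
  interpret t: Vector_Spaces.linear hscale hscale tmult by (rule tmult_linear)
  show "hbr (F[i := tmult (F ! i)]) m = tmult (hbr F) m" for m
    using F
  proof (induction m arbitrary: F)
    case 0
    then show ?case
      using i by (simp add: tmult_def hbr_0 map_update br_eq_0)
  next
    case (Suc m)
    let ?D = "\<lambda>j. F[j := hderiv (F ! j)]"
    have "hbr ((?D i)[i := tmult (?D i ! i)]) m = tmult (hbr (?D i)) m"
      by (rule Suc.IH) (use Suc.prems in simp)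
    then have 1: "hbr (F[i := tmult (hderiv (F ! i))]) m = tmult (hbr (?D i)) m"
      using Suc.prems i by simp
    have 2: "hbr ((?D j)[i := tmult (F ! i)]) m = tmult (hbr (?D j)) m" if "j \<noteq> i" for j
      using Suc.IH[of "?D j"] Suc.prems that by simp
    have "hbr (F[i := tmult (F ! i)]) (Suc m) =
        hbr (F[i := tmult (hderiv (F ! i)) + F ! i]) m +
        (\<Sum>j\<in>{..<n} - {i}. hbr ((?D j)[i := tmult (F ! i)]) m)"
      unfolding hbr_update_Suc[OF Suc.prems i] hderiv_tmult ..
    also have "\<dots> = tmult (hbr (?D i)) m + (\<Sum>j\<in>{..<n} - {i}. tmult (hbr (?D j)) m) + hbr F m"
      using Suc.prems i 1 2 by (simp add: hbr_update_add plus_fun_apply)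
    also have "tmult (hbr (?D i)) m + (\<Sum>j\<in>{..<n} - {i}. tmult (hbr (?D j)) m) =
        (\<Sum>j<n. tmult (hbr (?D j)) m)"
      by (rule sum.remove[symmetric]) (use i in auto)
    also have "(\<Sum>j<n. tmult (hbr (?D j)) m) + hbr F m = hderiv (tmult (hbr F)) m"
      by (simp add: hderiv_tmult hderiv_hbr t.sum sum_fun_apply plus_fun_apply)
    finally show ?case by (simp add: hderiv_def)
  qed
qed

section \<open>Orders and leading terms of products\<close>

text \<open>Orders add under multiplication: differentiating one slot lowers the total order bound
  by at most one, while the coefficient index drops by exactly one.\<close>

lemma hbr_below_order:
  assumes "length F = n" and "\<And>i j. i < n \<Longrightarrow> j < a i \<Longrightarrow> (F ! i) j = 0"
    and "m < (\<Sum>i<n. a i)"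
  shows "hbr F m = 0"
  using assms
proof (induction m arbitrary: F a)
  case 0
  then obtain i where "i < n" "0 < a i"
    by (metis gr0I lessThan_iff sum.neutral less_irrefl)
  with 0 show ?case by (auto simp: hbr_0 intro!: br_eq_0[of _ i])
next
  case (Suc m)
  \<comment> \<open>Truncated subtraction covers the bound \<open>a i = 0\<close>, which simply
    stays \<open>0\<close>.\<close>
  have "hbr (F[i := hderiv (F ! i)]) m = 0" if i: "i < n" for i
  proof (rule Suc.IH[of _ "a(i := a i - 1)"])
    have "(\<Sum>j<n. a j) = a i + (\<Sum>j\<in>{..<n} - {i}. a j)"
      by (rule sum.remove) (use i in auto)
    moreover have "(\<Sum>j<n. (a(i := a i - 1)) j) = (a i - 1) + (\<Sum>j\<in>{..<n} - {i}. a j)"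
      by (subst sum.remove[of _ i]) (use i in auto)
    ultimately show "m < (\<Sum>j<n. (a(i := a i - 1)) j)" using Suc.prems(3) by simp
  qed (use Suc.prems i in \<open>auto simp: nth_list_update hderiv_def split: if_splits\<close>)
  then show ?case by (simp add: hbr_Suc)
qed

text \<open>The factor \<open>c\<close> is the multinomial coefficient of \<open>a\<close>; only \<open>c > 0\<close> is needed.\<close>

lemma hbr_at_order:
  "\<exists>c::nat. 0 < c \<and> (\<forall>F. length F = n \<longrightarrow> (\<forall>i<n. \<forall>j<a i. (F ! i) j = 0) \<longrightarrow>
     hbr F (\<Sum>i<n. a i) = scale (of_nat c) (br (map (\<lambda>i. (F ! i) (a i)) [0..<n])))"
proof (induction "\<Sum>i<n. a i" arbitrary: a)
  case 0
  then have "a i = 0" if "i < n" for i using that by (metis finite_lessThan lessThan_iff sum_eq_0_iff)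
  then have F: "map (\<lambda>f. f 0) F = map (\<lambda>i. (F ! i) (a i)) [0..<n]"
    if "length F = n" for F :: "(nat \<Rightarrow> 'v) list"
    using that by (intro nth_equalityI) auto
  have "hbr F (\<Sum>i<n. a i) = scale (of_nat (Suc 0)) (br (map (\<lambda>i. (F ! i) (a i)) [0..<n]))"
    if "length F = n" for F
    unfolding 0[symmetric] hbr_0 F[OF that, symmetric] by simp
  then show ?case by (intro exI[of _ "Suc 0"] conjI allI impI) auto
next
  case (Suc m)
  let ?b = "\<lambda>i. a(i := a i - 1)"
  have sum_b: "(\<Sum>j<n. ?b i j) = m" if "i < n" "0 < a i" for i
  proof -
    have "(\<Sum>j<n. a j) = a i + (\<Sum>j\<in>{..<n} - {i}. a j)"
      by (rule sum.remove) (use that in auto)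
    moreover have "(\<Sum>j<n. ?b i j) = (a i - 1) + (\<Sum>j\<in>{..<n} - {i}. a j)"
      by (subst sum.remove[of _ i]) (use that in auto)
    ultimately show ?thesis using Suc(2) that by simp
  qed
  \<comment> \<open>Only slots with a positive bound contribute. The multinomial coefficient of
    \<open>a\<close> is the sum over them of the coefficients for \<open>a\<close> lowered by one at
    \<open>i\<close>; the induction hypothesis supplies these as \<open>c i\<close>.\<close>
  define I where "I = {i. i < n \<and> 0 < a i}"
  have "\<forall>i\<in>I. \<exists>c::nat. 0 < c \<and> (\<forall>F. length F = n \<longrightarrow> (\<forall>p<n. \<forall>j<?b i p. (F ! p) j = 0) \<longrightarrow>
     hbr F m = scale (of_nat c) (br (map (\<lambda>p. (F ! p) (?b i p)) [0..<n])))" (is "\<forall>i\<in>I. ?P i")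
  proof
    fix i assume "i \<in> I"
    then have i: "i < n" "0 < a i" by (auto simp: I_def)
    show "?P i"
      using Suc(1)[OF sum_b[OF i, symmetric]] unfolding sum_b[OF i] .
  qed
  then obtain c :: "nat \<Rightarrow> nat" where c: "\<And>i. i \<in> I \<Longrightarrow> 0 < c i"
    "\<And>i F. i \<in> I \<Longrightarrow> length F = n \<Longrightarrow> (\<And>p j. p < n \<Longrightarrow> j < ?b i p \<Longrightarrow> (F ! p) j = 0) \<Longrightarrow>
     hbr F m = scale (of_nat (c i)) (br (map (\<lambda>p. (F ! p) (?b i p)) [0..<n]))"
    by metis
  have I: "finite I" "I \<subseteq> {..<n}" "I \<noteq> {}"
  proof -
    show "I \<noteq> {}"
    proof
      assume "I = {}"
      then have "(\<Sum>i<n. a i) = 0" by (auto simp: I_def)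
      then show False using Suc(2) by simp
    qed
  qed (auto simp: I_def)
  have "hbr F (\<Sum>i<n. a i) =
      scale (of_nat (\<Sum>i\<in>I. c i)) (br (map (\<lambda>i. (F ! i) (a i)) [0..<n]))"
    if F: "length F = n" and ord: "\<forall>i<n. \<forall>j<a i. (F ! i) j = 0" for F
  proof -
    let ?v = "br (map (\<lambda>i. (F ! i) (a i)) [0..<n])"
    have "hbr F (Suc m) = (\<Sum>i\<in>I. hbr (F[i := hderiv (F ! i)]) m)"
      unfolding hbr_Suc
    proof (rule sum.mono_neutral_right)
      \<comment> \<open>In a slot with bound \<open>0\<close> differentiation leaves all the bounds
        \<open>a\<close> valid, and their sum \<open>Suc m\<close> exceeds \<open>m\<close>.\<close>
      show "\<forall>i\<in>{..<n} - I. hbr (F[i := hderiv (F ! i)]) m = 0"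
      proof
        fix i assume "i \<in> {..<n} - I"
        then show "hbr (F[i := hderiv (F ! i)]) m = 0"
          by (intro hbr_below_order[of _ a])
            (use F ord Suc(2)[symmetric] in \<open>auto simp: I_def nth_list_update\<close>)
      qed
    qed (use I in auto)
    also have "\<dots> = (\<Sum>i\<in>I. scale (of_nat (c i)) ?v)"
    proof (rule sum.cong)
      fix i assume i: "i \<in> I"
      have "hbr (F[i := hderiv (F ! i)]) m = scale (of_nat (c i))
          (br (map (\<lambda>p. (F[i := hderiv (F ! i)] ! p) (?b i p)) [0..<n]))"
        by (rule c(2)[OF i])
          (use F ord i in \<open>auto simp: I_def nth_list_update hderiv_def split: if_splits\<close>)
      also have "map (\<lambda>p. (F[i := hderiv (F ! i)] ! p) (?b i p)) [0..<n] =
          map (\<lambda>i. (F ! i) (a i)) [0..<n]"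
        using F i by (auto simp: I_def nth_list_update hderiv_def)
      finally show "hbr (F[i := hderiv (F ! i)]) m = scale (of_nat (c i)) ?v" .
    qed simp
    finally show ?thesis using Suc(2) by (simp add: scale_sum_left)
  qed
  moreover have "0 < (\<Sum>i\<in>I. c i)" using I c(1) by (simp add: sum_pos)
  ultimately show ?case by (intro exI[of _ "\<Sum>i\<in>I. c i"] conjI allI impI)
qed

end

section \<open>Leading coefficients of solvable ideals of series\<close>

text \<open>Characteristic zero makes the factors from \<open>tmult\<close> and the multinomial
  factors of \<open>hbr_at_order\<close> invertible.\<close>

locale leibniz_n_algebra_char_0 = leibniz_n_algebra scale n br
  for scale :: "'k::field_char_0 \<Rightarrow> 'v::ab_group_add \<Rightarrow> 'v" and n br
begin

interpretation S: leibniz_n_algebra hscale n hbr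
  by (rule leibniz_n_algebra_hurwitz)

text \<open>The index \<open>a\<close> is only a lower bound for the order, since \<open>f a\<close>
  may vanish; so \<open>0\<close> and cancelling sums need no case distinction.\<close>

definition leading :: "(nat \<Rightarrow> 'v) set \<Rightarrow> 'v set" where
  "leading N = {f a | f a. f \<in> N \<and> (\<forall>j<a. f j = 0)}"

lemma leadingI: "f \<in> N \<Longrightarrow> (\<And>j. j < a \<Longrightarrow> f j = 0) \<Longrightarrow> f a = v \<Longrightarrow> v \<in> leading N"
  unfolding leading_def by blast

lemma leadingE:
  assumes "v \<in> leading N"
  obtains f a where "f \<in> N" "\<forall>j<a. f j = 0" "f a = v"
  using assms unfolding leading_def by blast

text \<open>Two leading coefficients may sit at different orders \<open>a\<close> and
  \<open>b\<close>. Multiplication by powers of \<open>t\<close> moves both to order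
  \<open>a + b\<close>, where the series can be added.\<close>

lemma subspace_leading:
  assumes N: "S.subspace N" and t: "\<And>f. f \<in> N \<Longrightarrow> tmult f \<in> N"
  shows "subspace (leading N)"
proof -
  have shift: "\<exists>g\<in>N. (\<forall>j<a + b. g j = 0) \<and> g (a + b) = f a"
    if f: "f \<in> N" "\<forall>j<a. f j = 0" for f a b
  proof (induction b)
    case 0
    show ?case using f by auto
  next
    case (Suc b)
    then obtain g where g: "g \<in> N" "\<forall>j<a + b. g j = 0" "g (a + b) = f a" by blast
    \<comment> \<open>Here \<open>tmult\<close> multiplies the coefficient moved to index
      \<open>Suc (a + b)\<close> by that index; the inverse scalar restores it.\<close>
    let ?h = "hscale (inverse (of_nat (Suc (a + b)))) (tmult g)"
    have "?h \<in> N" by (intro S.subspace_scale[OF N] t g)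
    moreover have "?h j = 0" if "j < a + Suc b" for j
      using g(2) that by (cases j) (auto simp: hscale_def tmult_def)
    moreover have "?h (a + Suc b) = f a"
      using g by (simp add: hscale_def tmult_def del: of_nat_Suc)
    ultimately show ?case by blast
  qed
  show ?thesis
  proof (rule subspaceI)
    show "0 \<in> leading N"
      by (rule leadingI[of 0 _ 0]) (use S.subspace_0[OF N] in auto)
  next
    fix u v assume "u \<in> leading N" "v \<in> leading N"
    then obtain f a g b where f: "f \<in> N" "\<forall>j<a. f j = 0" "u = f a"
      and g: "g \<in> N" "\<forall>j<b. g j = 0" "v = g b" by (elim leadingE) blast
    obtain f' where f': "f' \<in> N" "\<forall>j<a + b. f' j = 0" "f' (a + b) = u"
      using shift[of f a b] f by auto
    obtain g' where g': "g' \<in> N" "\<forall>j<a + b. g' j = 0" "g' (a + b) = v"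
      using shift[of g b a] g by (auto simp: add.commute)
    have "f' + g' \<in> N" by (rule S.subspace_add[OF N f'(1) g'(1)])
    moreover have "\<forall>j<a + b. (f' + g') j = 0" using f' g' by (simp add: plus_fun_apply)
    moreover have "u + v = (f' + g') (a + b)" using f' g' by (simp add: plus_fun_apply)
    ultimately show "u + v \<in> leading N" unfolding leading_def by blast
  next
    fix c u assume "u \<in> leading N"
    then obtain f a where f: "f \<in> N" "\<forall>j<a. f j = 0" "u = f a" by (elim leadingE) blast
    have "hscale c f \<in> N" by (rule S.subspace_scale[OF N f(1)])
    moreover have "\<forall>j<a. hscale c f j = 0" "scale c u = hscale c f a"
      using f by (auto simp: hscale_def)
    ultimately show "scale c u \<in> leading N" unfolding leading_def by blast
  qed
qed

text \<open>\<open>A\<close> prescribes slot by slot where the representing series come from. Their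
  product vanishes below the sum of the order bounds and there equals a positive multiple of
  \<open>br xs\<close>, which is divided out.\<close>

lemma br_in_leading:
  assumes N: "S.subspace N" and xs: "length xs = n"
    and A: "\<And>i. i < n \<Longrightarrow> xs ! i \<in> leading (A i)"
    and br: "\<And>F. length F = n \<Longrightarrow> (\<And>i. i < n \<Longrightarrow> F ! i \<in> A i) \<Longrightarrow> hbr F \<in> N"
  shows "br xs \<in> leading N"
proof -
  have "\<forall>i. \<exists>f a. i < n \<longrightarrow> f \<in> A i \<and> (\<forall>j<a. f j = 0) \<and> f a = xs ! i"
    using A by (meson leadingE)
  then obtain f a where f: "\<And>i. i < n \<Longrightarrow> f i \<in> A i" "\<And>i j. i < n \<Longrightarrow> j < a i \<Longrightarrow> f i j = 0"
    "\<And>i. i < n \<Longrightarrow> f i (a i) = xs ! i" by metis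
  let ?F = "map f [0..<n]"
  obtain c :: nat where c: "0 < c"
    "hbr ?F (\<Sum>i<n. a i) = scale (of_nat c) (br (map (\<lambda>i. (?F ! i) (a i)) [0..<n]))"
    using hbr_at_order[of a] f(2) by force
  have "map (\<lambda>i. (?F ! i) (a i)) [0..<n] = xs"
    using xs f(3) by (intro nth_equalityI) auto
  with c have val: "hscale (inverse (of_nat c)) (hbr ?F) (\<Sum>i<n. a i) = br xs"
    by (simp add: hscale_def)
  have "\<forall>j<\<Sum>i<n. a i. hscale (inverse (of_nat c)) (hbr ?F) j = 0"
    using hbr_below_order[of ?F a] f(2) by (simp add: hscale_def)
  moreover have "hscale (inverse (of_nat c)) (hbr ?F) \<in> N"
    by (intro S.subspace_scale[OF N] br) (use f in auto)
  ultimately show ?thesis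
    using val by (intro leadingI[of "hscale (inverse (of_nat c)) (hbr ?F)" _ "\<Sum>i<n. a i"]) blast+
qed

lemma leading_UNIV: "v \<in> leading UNIV"
  by (rule leadingI[of "\<lambda>_. v" _ 0]) auto

text \<open>As \<open>1 \<le> k\<close>, the set \<open>P\<close> has an element, and
  \<open>t\<close> can be moved into that slot, where the induction hypothesis absorbs it.\<close>

lemma tmult_derived_series:
  assumes k: "1 \<le> k" and H: "S.subspace H" and t: "\<And>f. f \<in> H \<Longrightarrow> tmult f \<in> H"
  shows "f \<in> S.derived_series k H m \<Longrightarrow> tmult f \<in> S.derived_series k H m"
proof (induction m arbitrary: f)
  case 0
  then show ?case using t by simp
next
  case (Suc m)
  interpret t: Vector_Spaces.linear hscale hscale tmult by (rule tmult_linear)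
  have "S.derived_series k H (Suc m) \<subseteq> tmult -` S.derived_series k H (Suc m)"
  proof (rule S.derived_series_subset)
    show "S.subspace (tmult -` S.derived_series k H (Suc m))"
      by (rule t.subspace_vimage[OF S.subspace_derived_series[OF H]])
    fix P xs
    assume P: "P \<subseteq> {..<n}" "card P = k" and l: "length xs = n"
      and x: "\<And>i. i \<in> P \<Longrightarrow> xs ! i \<in> S.derived_series k H m"
    obtain i where i: "i \<in> P" using P k by fastforce
    have "hbr (xs[i := tmult (xs ! i)]) \<in> S.derived_series k H (Suc m)"
      by (rule S.br_in_derived_series[OF P])
        (use l x i P Suc.IH in \<open>auto simp: nth_list_update\<close>)
    then show "hbr xs \<in> tmult -` S.derived_series k H (Suc m)"
      using hbr_tmult[OF l, of i] i P by auto
  qed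
  then show ?case using Suc.prems by blast
qed

text \<open>Taking leading coefficients sends derived terms into derived terms by
  \<open>br_in_leading\<close>, with \<open>UNIV\<close> in the free slots, and the zero ideal of
  series has only \<open>0\<close> as a leading coefficient.\<close>

lemma solvable_ideal_leading:
  assumes k: "1 \<le> k" and H: "S.solvable_ideal k H" and t: "\<And>f. f \<in> H \<Longrightarrow> tmult f \<in> H"
  shows "solvable_ideal k (leading H)"
proof -
  have iH: "S.ideal H" using H by (simp add: S.solvable_ideal_def)
  have sH: "S.subspace H" using S.ideal_subspace[OF iH] .
  have sub: "subspace (leading (S.derived_series k H m))" for m
    by (intro subspace_leading S.subspace_derived_series sH tmult_derived_series[OF k sH t])
  have "ideal (leading H)"
    unfolding ideal_def
  proof (intro conjI allI impI)
    show "subspace (leading H)" by (intro subspace_leading sH t)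
    fix xs assume "length xs = n \<and> (\<exists>i<n. xs ! i \<in> leading H)"
    then obtain i where xs: "length xs = n" and i: "i < n" "xs ! i \<in> leading H" by auto
    show "br xs \<in> leading H"
    proof (rule br_in_leading[OF sH xs, where A = "\<lambda>j. if j = i then H else UNIV"])
      show "hbr F \<in> H" if "length F = n" "\<And>j. j < n \<Longrightarrow> F ! j \<in> (if j = i then H else UNIV)" for F
        by (rule S.br_in_ideal[OF iH that(1) i(1)]) (use that(2)[OF i(1)] in simp)
    qed (use i leading_UNIV in auto)
  qed
  moreover have ser: "derived_series k (leading H) m \<subseteq> leading (S.derived_series k H m)" for m
  proof (induction m)
    case (Suc m)
    show ?case
    proof (rule derived_series_subset[OF sub])
      fix P xs
      assume P: "P \<subseteq> {..<n}" "card P = k" and xs: "length xs = n"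
        and x: "\<And>i. i \<in> P \<Longrightarrow> xs ! i \<in> derived_series k (leading H) m"
      show "br xs \<in> leading (S.derived_series k H (Suc m))"
      proof (rule br_in_leading[OF S.subspace_derived_series[OF sH] xs,
            where A = "\<lambda>i. if i \<in> P then S.derived_series k H m else UNIV"])
        show "hbr F \<in> S.derived_series k H (Suc m)" if "length F = n"
          "\<And>i. i < n \<Longrightarrow> F ! i \<in> (if i \<in> P then S.derived_series k H m else UNIV)" for F
        proof (rule S.br_in_derived_series[OF P that(1)])
          show "F ! i \<in> S.derived_series k H m" if "i \<in> P" for i
            using \<open>\<And>i. i < n \<Longrightarrow> _\<close>[of i] that P by auto
        qed
      qed (use x Suc leading_UNIV in auto)
    qed
  qed simp
  moreover obtain m where m: "S.derived_series k H m = {0}" using H by (auto simp: S.solvable_ideal_def)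
  moreover have "leading {0} \<subseteq> {0}" by (auto simp: leading_def)
  moreover have "0 \<in> derived_series k (leading H) m"
    by (intro subspace_0 subspace_derived_series subspace_leading sH t)
  ultimately show ?thesis using ser[of m] unfolding solvable_ideal_def by (auto intro!: exI[of _ m])
qed

section \<open>Series with coefficients in a solvable ideal\<close>

text \<open>Each coefficient of a product of series is a sum of products of coefficients taken slot
  by slot, so the derived series can be bounded coefficientwise.\<close>

lemma solvable_ideal_series:
  assumes I: "solvable_ideal k I"
  shows "S.solvable_ideal k {f. range f \<subseteq> I}"
proof -
  have iI: "ideal I" using I by (simp add: solvable_ideal_def)
  have sub: "S.subspace {f. range f \<subseteq> A}" if "subspace A" for A
    by (rule S.subspaceI)
      (use that in \<open>auto simp: plus_fun_apply hscale_def subspace_0 subspace_add subspace_scale image_subset_iff\<close>)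
  \<comment> \<open>Differentiation only shifts coefficients and so preserves the constraint on the
    slots in \<open>P\<close>. A singleton \<open>P\<close> gives the ideal property, a
    \<open>P\<close> of size \<open>k\<close> the derived series.\<close>
  have coeff: "hbr F m \<in> B"
    if "subspace B" "length F = n" "\<And>i. i \<in> P \<Longrightarrow> range (F ! i) \<subseteq> A"
      "\<And>xs. length xs = n \<Longrightarrow> (\<And>i. i \<in> P \<Longrightarrow> xs ! i \<in> A) \<Longrightarrow> br xs \<in> B"
      "P \<subseteq> {..<n}" for A B P m and F :: "(nat \<Rightarrow> 'v) list"
    using that(2,3)
  proof (induction m arbitrary: F)
    case 0
    then show ?case unfolding hbr_0
      by (intro that(4)) (use that(5) in \<open>auto simp: subset_iff\<close>)
  next
    case (Suc m)
    have "hbr (F[i := hderiv (F ! i)]) m \<in> B" if "i < n" for i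
    proof (rule Suc.IH)
      show "range (F[i := hderiv (F ! i)] ! j) \<subseteq> A" if "j \<in> P" for j
        using Suc.prems that \<open>i < n\<close>
        by (cases "i = j") (auto simp: hderiv_def image_subset_iff)
    qed (use Suc.prems in simp)
    then show ?case unfolding hbr_Suc by (intro subspace_sum[OF that(1)]) auto
  qed
  have ideal: "S.ideal {f. range f \<subseteq> I}"
    unfolding S.ideal_def
  proof (intro conjI allI impI)
    show "S.subspace {f. range f \<subseteq> I}" by (rule sub[OF ideal_subspace[OF iI]])
    fix F :: "(nat \<Rightarrow> 'v) list"
    assume "length F = n \<and> (\<exists>i<n. F ! i \<in> {f. range f \<subseteq> I})"
    then obtain i where F: "length F = n" and i: "i < n" "range (F ! i) \<subseteq> I" by auto
    have "hbr F m \<in> I" for m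
      by (rule coeff[of I F "{i}" I])
        (use F i br_in_ideal[OF iI] ideal_subspace[OF iI] in auto)
    then show "hbr F \<in> {f. range f \<subseteq> I}" by auto
  qed
  have ser: "S.derived_series k {f. range f \<subseteq> I} m \<subseteq> {f. range f \<subseteq> derived_series k I m}" for m
  proof (induction m)
    case (Suc m)
    have sB: "subspace (derived_series k I (Suc m))"
      by (rule subspace_derived_series[OF ideal_subspace[OF iI]])
    show ?case
    proof (rule S.derived_series_subset[OF sub[OF sB]])
      fix P F
      assume P: "P \<subseteq> {..<n}" "card P = k" and F: "length F = n"
        and x: "\<And>i. i \<in> P \<Longrightarrow> F ! i \<in> S.derived_series k {f. range f \<subseteq> I} m"
      have "hbr F j \<in> derived_series k I (Suc m)" for j
      proof (rule coeff[OF sB F, of P "derived_series k I m"])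
        show "range (F ! i) \<subseteq> derived_series k I m" if "i \<in> P" for i
          using x[OF that] Suc by auto
      qed (use P br_in_derived_series[OF P] in auto)
      then show "hbr F \<in> {f. range f \<subseteq> derived_series k I (Suc m)}" by auto
    qed
  qed simp
  obtain m where m: "derived_series k I m = {0}" using I by (auto simp: solvable_ideal_def)
  have "S.derived_series k {f. range f \<subseteq> I} m \<subseteq> {f. range f \<subseteq> {0}}"
    using ser[of m] m by simp
  also have "\<dots> \<subseteq> {0}" by (auto simp: fun_eq_iff image_subset_iff)
  finally have "S.derived_series k {f. range f \<subseteq> I} m \<subseteq> {0}" .
  moreover have "0 \<in> S.derived_series k {f. range f \<subseteq> I} m"
    by (intro S.subspace_0 S.subspace_derived_series sub ideal_subspace iI)
  ultimately show ?thesis using ideal unfolding S.solvable_ideal_def by blast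
qed

section \<open>Derivations and the radical\<close>

text \<open>The image may leave \<open>I\<close>; landing in some solvable ideal is enough, because
  the radical is spanned by all of them. The witness is \<open>leading ?M\<close>.\<close>

lemma derivation_solvable_ideal:
  assumes k: "1 \<le> k" and der: "derivation d" and I: "solvable_ideal k I"
  shows "\<exists>I'. solvable_ideal k I' \<and> d ` I \<subseteq> I'"
proof -
  have lin: "Vector_Spaces.linear scale scale d" using der by (simp add: derivation_def)
  interpret d: Vector_Spaces.linear scale scale d by (rule lin)
  interpret e: Vector_Spaces.linear hscale hscale "hexp d" by (rule hexp_linear[OF lin])
  interpret t: Vector_Spaces.linear hscale hscale tmult by (rule tmult_linear)
  have sI: "subspace I" using I by (simp add: solvable_ideal_def ideal_def)
  let ?A = "{f. range f \<subseteq> I}"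
  let ?M = "S.span (?A \<union> hexp d ` ?A)"
  \<comment> \<open>Applying \<open>hexp_inverse\<close> to \<open>- d\<close> instead of
    \<open>d\<close> gives a right inverse of \<open>hexp d\<close>, hence surjectivity.\<close>
  have "hexp d (hexp (\<lambda>v. - d v) f) = f" for f
    using hexp_inverse[of "\<lambda>v. - d v" f] by (simp add: d.add)
  then have "surj (hexp d)" by (metis surjI)
  then have M: "S.solvable_ideal k ?M"
    by (intro S.solvable_ideal_sum solvable_ideal_series[OF I] S.solvable_ideal_image e.linear_axioms
        hexp_hbr[OF der])
  have tA: "tmult f \<in> ?A" if "f \<in> ?A" for f
    using that sI by (auto simp: tmult_def intro: subspace_scale)
  have "?M \<subseteq> tmult -` ?M"
  proof (rule S.span_minimal)
    show "S.subspace (tmult -` ?M)" by (rule t.subspace_vimage) simp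
    have "tmult f \<in> ?A \<union> hexp d ` ?A" if "f \<in> ?A \<union> hexp d ` ?A" for f
      using that
    proof
      assume "f \<in> hexp d ` ?A"
      then obtain g where "g \<in> ?A" "tmult f = hexp d (tmult g)"
        by (auto simp: hexp_tmult[OF lin])
      then show ?thesis using tA[of g] by blast
    qed (use tA[of f] in blast)
    then show "?A \<union> hexp d ` ?A \<subseteq> tmult -` ?M"
      by (intro subsetI vimageI2 S.span_base)
  qed
  then have tM: "\<And>f. f \<in> ?M \<Longrightarrow> tmult f \<in> ?M" by blast
  have "d x \<in> leading ?M" if x: "x \<in> I" for x
  proof -
    \<comment> \<open>The constant series \<open>x\<close>: in \<open>hexp d f - f\<close> the
      coefficient at \<open>0\<close> cancels, and the one at \<open>Suc 0\<close> is
      \<open>d x\<close>.\<close>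
    define f :: "nat \<Rightarrow> 'v" where "f = (\<lambda>m. if m = 0 then x else 0)"
    have "f \<in> ?A" using x subspace_0[OF sI] by (auto simp: f_def)
    then have "hexp d f - f \<in> ?M" by (intro S.span_diff) (auto intro: S.span_base)
    moreover have "(hexp d f - f) (Suc 0) = d x"
      by (simp add: f_def hmap_def hderiv_def plus_fun_apply)
    moreover have "\<forall>j<Suc 0. (hexp d f - f) j = 0" by simp
    ultimately show ?thesis by (intro leadingI[of "hexp d f - f" _ "Suc 0"]) auto
  qed
  then show ?thesis using solvable_ideal_leading[OF k M tM] by blast
qed

end

theorem theorem4p5:
  fixes scale :: "'k::field_char_0 \<Rightarrow> 'v::ab_group_add \<Rightarrow> 'v"
    and Basis :: "'v set"
    and n k :: nat
    and br :: "'v list \<Rightarrow> 'v"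
    and d :: "'v \<Rightarrow> 'v"
  assumes "leibniz_n_algebra scale n br"
    and "finite_dimensional_vector_space scale Basis"
    and "1 \<le> k" and "k \<le> n"
    and "leibniz_n_algebra.derivation scale n br d"
  shows "d ` leibniz_n_algebra.solvable_radical scale n br k
           \<subseteq> leibniz_n_algebra.solvable_radical scale n br k"
proof -
  interpret leibniz_n_algebra_char_0 scale n br
    using assms(1) by (rule leibniz_n_algebra_char_0.intro)
  interpret d: Vector_Spaces.linear scale scale d
    using assms(5) by (simp add: derivation_def)
  \<comment> \<open>The union generates the radical, so stability of the union passes to its span by
    linearity of \<open>d\<close>.\<close>
  have "d ` \<Union>{I. solvable_ideal k I} \<subseteq> \<Union>{I. solvable_ideal k I}"
    using derivation_solvable_ideal[OF assms(3,5)] by fast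
  then show ?thesis
    unfolding solvable_radical_def d.span_image[symmetric] by (rule span_mono)
qed

end
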